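(* Let $N\ge 2$, $M=\binom{N}{2}$, and let $(m_1,n_1),\dots,(m_M,n_M)$ be the pairs $(m,n)$ with $1\le m<n\le N$ listed in lexicographic order. Given $\psi=(\psi_1,\dots,\psi_M)\in\Psi^M$, call an $N$-tuple $(x_1,\dots,x_N)$ of pairwise distinct rational numbers a solution for $\psi$ if $x_{m_k}+x_{n_k}=\psi_k$ for all $1\le k\le M$. (For such a solution the points $(x_i,x_i^2)$ form an $N$-point rational distance set on $y=x^2$.) <br>(1) If $N=2$, then for every $\psi_1\in\Psi$ there are infinitely many solutions $(x_1,x_2)$ for $\psi_1$. <br>(2) If $N=3$, then for every $(\psi_1,\psi_2,\psi_3)\in\Psi^3$ satisfying the Distinct Coordinates condition there is exactly one solution, namely $x_1=\tfrac12(\psi_1+\psi_2-\psi_3)$, $x_2=\tfrac12(\psi_1-\psi_2+\psi_3)$, $x_3=\tfrac12(-\psi_1+\psi_2+\psi_3)$. <br>(3) If $N\ge 4$, then for $\psi\in\Psi^M$ a solution exists if and only if $\psi$ satisfies both the Distinct Coordinates condition and the Existence Condition; in that case the solution is unique and is given by $x_1=\tfrac12(\psi_1+\psi_2-\psi_N)$, $x_2=\tfrac12(\psi_1-\psi_2+\psi_N)$, $x_3=\tfrac12(-\psi_1+\psi_2+\psi_N)$, and $x_i=\tfrac12(-\psi_1-\psi_2+2\psi_{i-1}+\psi_N)$ for $4\le i\le N$.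
   Context: A Pythagorean triplet is a triple $(\alpha,\beta,\gamma)$ of nonzero integers with $\alpha^2+\beta^2=\gamma^2$, $\gamma>0$; its Pythagorean ratio is $\beta/\alpha$, and $0$ is also counted as a Pythagorean ratio. $\Psi$ denotes the set of all Pythagorean ratios. A rational distance set $\mathrm{RDS}(N)$ on $y=x^2$ is a set of $N$ points on the parabola with rational coordinates and all pairwise distances rational. In the lexicographic order of pairs, $\psi_k$ for $1\le k\le N-1$ is attached to the pair $(1,k+1)$ and $\psi_N$ to the pair $(2,3)$. <br>Distinct Coordinates condition (for $N\ge3$): $\psi_1\ne\psi_2$, $\psi_1\ne\psi_N$, $\psi_2\ne\psi_N$; $\psi_{i-1}\ne\psi_{j-1}$ for all $4\le i<j\le N$; and for all $4\le j\le N$: $\psi_1\ne\psi_{j-1}$, $\psi_2\ne\psi_{j-1}$, $\psi_1+\psi_2\ne\psi_{j-1}+\psi_N$. (This is equivalent to the $x_i$ given by the displayed formulas being pairwise distinct.) <br>Existence Condition (for $N\ge4$): for $1\le i\le N-3$, $\psi_2+\psi_{N+i}=\psi_N+\psi_{i+2}$; for $N-2\le i\le 2N-6$, $\psi_1+\psi_{N+i}=\psi_N+\psi_{i+5-N}$; for $2N-5\le i\le M-N$, $\psi_1+\psi_2+\psi_{N+i}=\psi_N+\psi_{m'_t+2}+\psi_{n'_t+2}$ where $t=i+6-2N$ and $(m'_t,n'_t)$ is the $t$-th pair in the lexicographic list of pairs $(m,n)$ with $1\le m<n\le N-3$. *)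

theory Defs
  imports "HOL-Analysis.Analysis"
begin

definition pythagorean_triplet :: "int \<Rightarrow> int \<Rightarrow> int \<Rightarrow> bool" where
  "pythagorean_triplet \<alpha> \<beta> \<gamma> \<longleftrightarrow>
     \<alpha> \<noteq> 0 \<and> \<beta> \<noteq> 0 \<and> \<gamma> > 0 \<and> \<alpha>\<^sup>2 + \<beta>\<^sup>2 = \<gamma>\<^sup>2"

definition pythagorean_ratios :: "rat set" where
  "pythagorean_ratios =
     insert 0 {of_int \<beta> / of_int \<alpha> | \<alpha> \<beta> \<gamma>. pythagorean_triplet \<alpha> \<beta> \<gamma>}"

definition RDS_parabola :: "nat \<Rightarrow> (real \<times> real) set \<Rightarrow> bool" where
  "RDS_parabola N S \<longleftrightarrow>
     finite S \<and> card S = N \<and>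
     (\<forall>(u, v)\<in>S. u \<in> \<rat> \<and> v \<in> \<rat> \<and> v = u\<^sup>2) \<and>
     (\<forall>p\<in>S. \<forall>q\<in>S. dist p q \<in> \<rat>)"

definition lex_pairs :: "nat \<Rightarrow> (nat \<times> nat) list" where
  "lex_pairs N = [(m, n). m \<leftarrow> [1..<Suc N], n \<leftarrow> [Suc m..<Suc N]]"

lemma set_lex_pairs: "set (lex_pairs N) = {(m, n). 1 \<le> m \<and> m < n \<and> n \<le> N}"
  by (fastforce simp: lex_pairs_def simp del: upt_Suc)

lemma sorted_lex_pairs:
  "sorted_wrt (\<lambda>p q. (p, q) \<in> less_than <*lex*> less_than) (lex_pairs N)"
proof -
  let ?lex = "\<lambda>p q. (p, q) \<in> less_than <*lex*> less_than"
  have row: "sorted_wrt ?lex (map (\<lambda>n. (m, n)) [a..<b])" for m a b :: nat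
    by (simp add: sorted_wrt_map)
  have "sorted_wrt ?lex [(m, n). m \<leftarrow> ms, n \<leftarrow> [Suc m..<Suc N]]"
    if "sorted_wrt (<) ms" for ms :: "nat list"
    using that
    by (induction ms) (auto simp: sorted_wrt_append row simp del: upt_Suc)
  from this[of "[1..<Suc N]"] show ?thesis
    unfolding lex_pairs_def using sorted_wrt_upt by blast
qed

lemma length_lex_pairs: "length (lex_pairs N) = N choose 2"
proof -
  have *: "length (lex_pairs N) = (\<Sum>m=1..N. N - m)"
    by (simp add: lex_pairs_def length_concat o_def sum_list_distinct_conv_sum_set
        atLeastLessThanSuc_atLeastAtMost del: upt_Suc)
  also have "\<dots> = \<Sum>{..<N}"
    by (rule sum.reindex_bij_witness[of _ "\<lambda>i. N - i" "\<lambda>i. N - i"]) auto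
  also have "\<dots> = N choose 2"
    by (induction N) (auto simp: numeral_2_eq_2)
  finally show ?thesis .
qed

text \<open>The \<^emph>\<open>k\<close>-th pair, counting from 1; intended for \<^emph>\<open>k\<close> between 1 and \<^term>\<open>N choose 2\<close>.\<close>
definition lex_pair :: "nat \<Rightarrow> nat \<Rightarrow> nat \<times> nat" where
  "lex_pair N k = lex_pairs N ! (k - 1)"

text \<open>An \<^emph>\<open>N\<close>-tuple is an extensional function on \<^term>\<open>{1..N}\<close>, so that distinct functions
  are distinct tuples and solutions can be counted.\<close>
definition is_solution :: "nat \<Rightarrow> (nat \<Rightarrow> rat) \<Rightarrow> (nat \<Rightarrow> rat) \<Rightarrow> bool" where
  "is_solution N \<psi> x \<longleftrightarrow>
     x \<in> {1..N} \<rightarrow>\<^sub>E UNIV \<and> inj_on x {1..N} \<and>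
     (\<forall>k\<in>{1..N choose 2}. x (fst (lex_pair N k)) + x (snd (lex_pair N k)) = \<psi> k)"

definition distinct_coordinates :: "nat \<Rightarrow> (nat \<Rightarrow> rat) \<Rightarrow> bool" where
  "distinct_coordinates N \<psi> \<longleftrightarrow>
     \<psi> 1 \<noteq> \<psi> 2 \<and> \<psi> 1 \<noteq> \<psi> N \<and> \<psi> 2 \<noteq> \<psi> N \<and>
     (\<forall>i j. 4 \<le> i \<and> i < j \<and> j \<le> N \<longrightarrow> \<psi> (i - 1) \<noteq> \<psi> (j - 1)) \<and>
     (\<forall>j\<in>{4..N}. \<psi> 1 \<noteq> \<psi> (j - 1) \<and> \<psi> 2 \<noteq> \<psi> (j - 1) \<and>
        \<psi> 1 + \<psi> 2 \<noteq> \<psi> (j - 1) + \<psi> N)"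

text \<open>Meant for \<open>N \<ge> 4\<close>; then no subtraction of natural numbers below is truncated.\<close>
definition existence_condition :: "nat \<Rightarrow> (nat \<Rightarrow> rat) \<Rightarrow> bool" where
  "existence_condition N \<psi> \<longleftrightarrow>
     (\<forall>i\<in>{1..N - 3}. \<psi> 2 + \<psi> (N + i) = \<psi> N + \<psi> (i + 2)) \<and>
     (\<forall>i\<in>{N - 2..2 * N - 6}. \<psi> 1 + \<psi> (N + i) = \<psi> N + \<psi> (i + 5 - N)) \<and>
     (\<forall>i\<in>{2 * N - 5..(N choose 2) - N}.
        let (m', n') = lex_pair (N - 3) (i + 6 - 2 * N)
        in \<psi> 1 + \<psi> 2 + \<psi> (N + i) = \<psi> N + \<psi> (m' + 2) + \<psi> (n' + 2))"

end

theory Submission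
  imports Defs
begin

text \<open>The first three equations \<open>x\<^sub>1 + x\<^sub>2 = \<psi>\<^sub>1\<close>, \<open>x\<^sub>1 + x\<^sub>3 = \<psi>\<^sub>2\<close>, \<open>x\<^sub>2 + x\<^sub>3 = \<psi>\<^sub>N\<close> determine
  \<open>x\<^sub>1, x\<^sub>2, x\<^sub>3\<close>, and then \<open>x\<^sub>1 + x\<^sub>i = \<psi>\<^sub>i\<^sub>-\<^sub>1\<close> determines \<open>x\<^sub>i\<close>. Substituting these values into the
  remaining equations, namely the rest of the second row, the third row, and the rows from the fourth
  on, yields the three families of the Existence Condition. The points form a rational
  distance set because the distance of \<open>(u, u\<^sup>2)\<close> and \<open>(v, v\<^sup>2)\<close> is \<open>\<bar>u - v\<bar> \<surd>(1 + (u + v)\<^sup>2)\<close>.\<close>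

section \<open>Recursive structure of the lexicographic list of pairs\<close>

lemma lex_pairs_Suc:
  "lex_pairs (Suc N) = map (Pair 1) [2..<Suc (Suc N)] @ map (map_prod Suc Suc) (lex_pairs N)"
proof -
  \<comment> \<open>The row of pairs starting with 1 is split off. The other rows start at 2 or
    later, so they are the rows for \<open>N\<close> with both entries raised by one.\<close>
  have "[1..<Suc (Suc N)] = 1 # map Suc [1..<Suc N]"
    by (subst upt_conv_Cons) (simp_all add: map_Suc_upt del: upt_Suc)
  moreover have "map (Pair (Suc m)) [Suc (Suc m)..<Suc (Suc N)]
      = map (map_prod Suc Suc) (map (Pair m) [Suc m..<Suc N])" for m
    by (simp add: o_def flip: map_Suc_upt del: upt_Suc)
  ultimately show ?thesis
    by (simp add: lex_pairs_def map_concat o_def numeral_2_eq_2 del: upt_Suc)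
qed

lemma lex_pair_Suc_first_row:
  assumes "k \<in> {1..N}"
  shows "lex_pair (Suc N) k = (1, Suc k)"
  using assms by (cases k) (simp_all add: lex_pair_def lex_pairs_Suc nth_append del: upt_Suc)

lemma lex_pair_Suc_later_rows:
  assumes "k \<in> {1..N choose 2}"
  shows "lex_pair (Suc N) (N + k) = map_prod Suc Suc (lex_pair N k)"
  using assms
  by (cases k) (simp_all add: lex_pair_def lex_pairs_Suc nth_append length_lex_pairs del: upt_Suc)

text \<open>The equations are separated from injectivity and extensionality so that they can be
  passed to a shifted tuple: \<open>\<lambda>i. x (Suc i)\<close> need not be extensional on the
  smaller index set.\<close>

definition pair_sums :: "nat \<Rightarrow> (nat \<Rightarrow> rat) \<Rightarrow> (nat \<Rightarrow> rat) \<Rightarrow> bool" where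
  "pair_sums N \<psi> x \<longleftrightarrow>
     (\<forall>k\<in>{1..N choose 2}. x (fst (lex_pair N k)) + x (snd (lex_pair N k)) = \<psi> k)"

lemma ball_shift:
  fixes a b c :: nat
  shows "(\<forall>i\<in>{c + a..c + b}. P i) \<longleftrightarrow> (\<forall>i\<in>{a..b}. P (c + i))"
proof -
  have "{c + a..c + b} = (+) c ` {a..b}"
    by (simp add: add.commute)
  then show ?thesis
    by (simp only: ball_simps)
qed

lemma ball_atLeastAtMost_add:
  fixes a b :: nat
  shows "(\<forall>k\<in>{1..a + b}. P k) \<longleftrightarrow> (\<forall>k\<in>{1..a}. P k) \<and> (\<forall>k\<in>{1..b}. P (a + k))"
proof -
  have "{1..a + b} = {1..a} \<union> {a + 1..a + b}"
    by auto
  then show ?thesis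
    by (simp only: ball_Un ball_shift)
qed

text \<open>The row of 1 occupies the first \<open>N\<close> indices. What remains is a system of
  the same kind in the coordinates from the second on, which permits peeling off row after
  row.\<close>

lemma pair_sums_Suc:
  "pair_sums (Suc N) \<psi> x \<longleftrightarrow>
     (\<forall>i\<in>{1..N}. x 1 + x (Suc i) = \<psi> i) \<and> pair_sums N (\<lambda>k. \<psi> (N + k)) (\<lambda>i. x (Suc i))"
proof -
  have "Suc N choose 2 = N + (N choose 2)"
    by (simp add: numeral_2_eq_2)
  then show ?thesis
    by (simp add: pair_sums_def ball_atLeastAtMost_add lex_pair_Suc_first_row
        lex_pair_Suc_later_rows del: atLeastAtMost_iff One_nat_def)
qed

section \<open>Solving the linear system\<close>

definition coords :: "nat \<Rightarrow> (nat \<Rightarrow> rat) \<Rightarrow> nat \<Rightarrow> rat" where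
  "coords N \<psi> i =
     (if i = 1 then (\<psi> 1 + \<psi> 2 - \<psi> N) / 2
      else if i = 2 then (\<psi> 1 - \<psi> 2 + \<psi> N) / 2
      else if i = 3 then (- \<psi> 1 + \<psi> 2 + \<psi> N) / 2
      else (- \<psi> 1 - \<psi> 2 + 2 * \<psi> (i - 1) + \<psi> N) / 2)"

text \<open>With \<open>N = K + 3\<close> no truncated subtraction is left, and the three index
  ranges, moved back by 0, \<open>K\<close> and \<open>2 * K\<close>, all start at 1, ready to be
  matched with rows of the system. The case \<open>K = 0\<close> is included.\<close>

lemma existence_condition_add_3:
  "existence_condition (K + 3) \<psi> \<longleftrightarrow>
     (\<forall>i\<in>{1..K}. \<psi> 2 + \<psi> (K + 3 + i) = \<psi> (K + 3) + \<psi> (i + 2)) \<and>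
     (\<forall>i\<in>{1..K}. \<psi> 1 + \<psi> (2 * K + 3 + i) = \<psi> (K + 3) + \<psi> (i + 2)) \<and>
     (\<forall>k\<in>{1..K choose 2}. \<psi> 1 + \<psi> 2 + \<psi> (3 * K + 3 + k) =
        \<psi> (K + 3) + \<psi> (fst (lex_pair K k) + 2) + \<psi> (snd (lex_pair K k) + 2))"
proof -
  have choose: "(K + 3) choose 2 = 3 * K + 3 + (K choose 2)"
    by (simp add: eval_nat_numeral)
  have third_row: "{K + 3 - 2..2 * (K + 3) - 6} = {K + 1..K + K}"
    by (rule arg_cong2[where f = atLeastAtMost]) simp_all
  have later_rows:
    "{2 * (K + 3) - 5..(K + 3 choose 2) - (K + 3)} = {2 * K + 1..2 * K + (K choose 2)}"
    unfolding choose by (rule arg_cong2[where f = atLeastAtMost]) simp_all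
  have indices: "K + 3 - 3 = K" "K + 3 + (K + i) = 2 * K + 3 + i" "K + i + 5 - (K + 3) = i + 2"
    "K + 3 + (2 * K + i) = 3 * K + 3 + i" "2 * K + i + 6 - 2 * (K + 3) = i" for i
    by simp_all
  show ?thesis
    unfolding existence_condition_def third_row later_rows ball_shift
    by (simp only: indices Let_def case_prod_unfold)
qed

text \<open>The first three rows have lengths \<open>K + 2\<close>, \<open>K + 1\<close> and
  \<open>K\<close>, whence the offsets \<open>K + 2\<close>, \<open>2 * K + 3\<close> and
  \<open>3 * K + 3\<close>.\<close>

lemma pair_sums_add_3:
  "pair_sums (K + 3) \<psi> x \<longleftrightarrow>
     (\<forall>i\<in>{1..K + 2}. x 1 + x (i + 1) = \<psi> i) \<and>
     (\<forall>i\<in>{1..K + 1}. x 2 + x (i + 2) = \<psi> (K + 2 + i)) \<and>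
     (\<forall>i\<in>{1..K}. x 3 + x (i + 3) = \<psi> (2 * K + 3 + i)) \<and>
     (\<forall>k\<in>{1..K choose 2}. x (fst (lex_pair K k) + 3) + x (snd (lex_pair K k) + 3) =
        \<psi> (3 * K + 3 + k))"
proof -
  have "pair_sums (K + 3) \<psi> x = pair_sums (Suc (Suc (Suc K))) \<psi> x"
    by (simp add: numeral_3_eq_3)
  then show ?thesis
    unfolding pair_sums_Suc unfolding pair_sums_def
    by (simp only:) (simp add: numeral_3_eq_3 numeral_2_eq_2 add.assoc)
qed

text \<open>These are \<open>K + 3\<close> equations in as many unknowns. As a graph, the pairs form
  a triangle on 1, 2, 3 with all other vertices attached to 1; the odd cycle makes the solution
  unique.\<close>

lemma first_rows_iff_coords:
  "(\<forall>i\<in>{1..K + 2}. x 1 + x (i + 1) = \<psi> i) \<and> x 2 + x 3 = \<psi> (K + 3) \<longleftrightarrow>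
     (\<forall>i\<in>{1..K + 3}. x i = coords (K + 3) \<psi> i)"
  (is "?L \<longleftrightarrow> ?R")
proof
  assume L: ?L
  then have first_row: "x 1 + x (i + 1) = \<psi> i" if "i \<in> {1..K + 2}" for i
    using that by blast
  have first: "x 1 + x 2 = \<psi> 1" "x 1 + x 3 = \<psi> 2"
    using first_row[of 1] first_row[of 2] by (simp_all add: numeral_2_eq_2 numeral_3_eq_3)
  have later: "x 1 + x i = \<psi> (i - 1)" if "i \<in> {4..K + 3}" for i
  proof -
    have "i - 1 \<in> {1..K + 2}"
      using that by auto
    then show ?thesis
      using first_row[of "i - 1"] that by simp
  qed
  show ?R
  proof
    fix i
    assume "i \<in> {1..K + 3}"
    then consider "i = 1" | "i = 2" | "i = 3" | "i \<in> {4..K + 3}"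
      by fastforce
    then show "x i = coords (K + 3) \<psi> i"
      by cases (use first later[of i] L in \<open>auto simp: coords_def\<close>)
  qed
next
  assume R: ?R
  then have "x 1 + x (i + 1) = \<psi> i" if "i \<in> {1..K + 2}" for i
    using that by (auto simp: coords_def field_simps numeral_2_eq_2)
  moreover have "x 2 + x 3 = \<psi> (K + 3)"
    using R by (simp add: coords_def field_simps)
  ultimately show ?L
    by blast
qed

lemma pair_sums_iff_coords:
  "pair_sums (K + 3) \<psi> x \<longleftrightarrow>
     (\<forall>i\<in>{1..K + 3}. x i = coords (K + 3) \<psi> i) \<and> existence_condition (K + 3) \<psi>"
proof -
  let ?c = "\<forall>i\<in>{1..K + 3}. x i = coords (K + 3) \<psi> i"
  \<comment> \<open>The second row begins with the pair (2, 3), whose index \<open>K + 2 + 1\<close>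
    is \<open>N\<close>. This equation is detached to join the first row.\<close>
  have second_row: "(\<forall>i\<in>{1..K + 1}. x 2 + x (i + 2) = \<psi> (K + 2 + i)) \<longleftrightarrow>
      x 2 + x 3 = \<psi> (K + 3) \<and> (\<forall>i\<in>{1..K}. x 2 + x (i + 3) = \<psi> (K + 3 + i))"
    using ball_atLeastAtMost_add[of 1 K "\<lambda>i. x 2 + x (i + 2) = \<psi> (K + 2 + i)"]
    by (simp add: numeral_3_eq_3 numeral_2_eq_2)
  have "pair_sums (K + 3) \<psi> x \<longleftrightarrow> ?c \<and>
     (\<forall>i\<in>{1..K}. x 2 + x (i + 3) = \<psi> (K + 3 + i)) \<and>
     (\<forall>i\<in>{1..K}. x 3 + x (i + 3) = \<psi> (2 * K + 3 + i)) \<and>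
     (\<forall>k\<in>{1..K choose 2}. x (fst (lex_pair K k) + 3) + x (snd (lex_pair K k) + 3) =
        \<psi> (3 * K + 3 + k))"
    unfolding pair_sums_add_3 second_row first_rows_iff_coords[symmetric] by blast
  \<comment> \<open>Under the formulas for the coordinates each leftover equation becomes, one by
    one, an equation of the Existence Condition.\<close>
  moreover have "existence_condition (K + 3) \<psi> \<longleftrightarrow>
     (\<forall>i\<in>{1..K}. x 2 + x (i + 3) = \<psi> (K + 3 + i)) \<and>
     (\<forall>i\<in>{1..K}. x 3 + x (i + 3) = \<psi> (2 * K + 3 + i)) \<and>
     (\<forall>k\<in>{1..K choose 2}. x (fst (lex_pair K k) + 3) + x (snd (lex_pair K k) + 3) =
        \<psi> (3 * K + 3 + k))" if c: ?c
  proof -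
    have x2: "x 2 = (\<psi> 1 - \<psi> 2 + \<psi> (K + 3)) / 2" and x3: "x 3 = (- \<psi> 1 + \<psi> 2 + \<psi> (K + 3)) / 2"
      using c by (simp_all add: coords_def)
    have xi: "x (i + 3) = (- \<psi> 1 - \<psi> 2 + 2 * \<psi> (i + 2) + \<psi> (K + 3)) / 2" if "i \<in> {1..K}" for i
      using c that by (simp add: coords_def)
    \<comment> \<open>Both entries of a listed pair must lie in the range where the formula
      \<open>xi\<close> applies.\<close>
    have bounds: "fst (lex_pair K k) \<in> {1..K}" "snd (lex_pair K k) \<in> {1..K}"
      if "k \<in> {1..K choose 2}" for k
    proof -
      have "lex_pair K k \<in> set (lex_pairs K)"
        using that unfolding lex_pair_def by (intro nth_mem) (auto simp: length_lex_pairs)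
      then show "fst (lex_pair K k) \<in> {1..K}" "snd (lex_pair K k) \<in> {1..K}"
        by (auto simp: set_lex_pairs)
    qed
    show ?thesis
      unfolding existence_condition_add_3
      by (intro arg_cong2[where f = "(\<and>)"] ball_cong refl)
        (simp_all only: x2 x3 xi bounds, auto simp: field_simps)
  qed
  ultimately show ?thesis
    by blast
qed

section \<open>Distinct coordinates and the description of all solutions\<close>

lemma inj_on_coords_iff:
  assumes "N \<ge> 3"
  shows "inj_on (coords N \<psi>) {1..N} \<longleftrightarrow> distinct_coordinates N \<psi>"
proof -
  let ?c = "coords N \<psi>"
  have "{1..N} = insert 1 (insert 2 (insert 3 {4..N}))"
    using assms by auto
  then have "inj_on ?c {1..N} \<longleftrightarrow>
      (?c 1 \<noteq> ?c 2 \<and> ?c 1 \<noteq> ?c 3 \<and> ?c 2 \<noteq> ?c 3) \<and>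
      (\<forall>j\<in>{4..N}. ?c 1 \<noteq> ?c j \<and> ?c 2 \<noteq> ?c j \<and> ?c 3 \<noteq> ?c j) \<and> inj_on ?c {4..N}"
    by auto
  \<comment> \<open>Each inequality says that a coordinate difference is nonzero: for instance
    \<open>?c 1 - ?c 2 = \<psi> 2 - \<psi> N\<close>, and for j \<ge> 4 \<open>?c 1 - ?c j = \<psi>
    1 + \<psi> 2 - \<psi> (j - 1) - \<psi> N\<close>.\<close>
  moreover have "(?c 1 \<noteq> ?c 2 \<and> ?c 1 \<noteq> ?c 3 \<and> ?c 2 \<noteq> ?c 3) \<longleftrightarrow>
      \<psi> 1 \<noteq> \<psi> 2 \<and> \<psi> 1 \<noteq> \<psi> N \<and> \<psi> 2 \<noteq> \<psi> N"
    by (auto simp: coords_def)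
  moreover have "(\<forall>j\<in>{4..N}. ?c 1 \<noteq> ?c j \<and> ?c 2 \<noteq> ?c j \<and> ?c 3 \<noteq> ?c j) \<longleftrightarrow>
      (\<forall>j\<in>{4..N}. \<psi> 1 \<noteq> \<psi> (j - 1) \<and> \<psi> 2 \<noteq> \<psi> (j - 1) \<and>
        \<psi> 1 + \<psi> 2 \<noteq> \<psi> (j - 1) + \<psi> N)"
    by (intro ball_cong refl) (auto simp: coords_def)
  moreover have "inj_on ?c {4..N} \<longleftrightarrow> inj_on (\<lambda>i. \<psi> (i - 1)) {4..N}"
    unfolding inj_on_def by (intro ball_cong refl) (simp add: coords_def)
  moreover have "\<dots> \<longleftrightarrow> (\<forall>i j. 4 \<le> i \<and> i < j \<and> j \<le> N \<longrightarrow> \<psi> (i - 1) \<noteq> \<psi> (j - 1))"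
    (is "?inj \<longleftrightarrow> ?neq")
  proof
    show ?neq if ?inj
      using inj_onD[OF that] by fastforce
    show ?inj if ?neq
      using that by (intro linorder_inj_onI') auto
  qed
  ultimately show ?thesis
    unfolding distinct_coordinates_def by blast
qed

text \<open>The right-hand side pins \<open>x\<close> to one function, so existence, uniqueness and
  the formulas can all be read off for every N \<ge> 3.\<close>

lemma is_solution_iff:
  assumes "N \<ge> 3"
  shows "is_solution N \<psi> x \<longleftrightarrow>
    x = restrict (coords N \<psi>) {1..N} \<and> distinct_coordinates N \<psi> \<and> existence_condition N \<psi>"
proof -
  obtain K where N: "N = K + 3"
    using assms by (metis add.commute le_Suc_ex)
  have "is_solution N \<psi> x \<longleftrightarrow>
      x \<in> {1..N} \<rightarrow>\<^sub>E UNIV \<and> inj_on x {1..N} \<and> pair_sums N \<psi> x"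
    by (simp only: is_solution_def pair_sums_def)
  also have "\<dots> \<longleftrightarrow> x \<in> extensional {1..N} \<and> inj_on x {1..N} \<and>
      (\<forall>i\<in>{1..N}. x i = coords N \<psi> i) \<and> existence_condition N \<psi>"
    by (simp add: N pair_sums_iff_coords PiE_def)
  also have "\<dots> \<longleftrightarrow> x = restrict (coords N \<psi>) {1..N} \<and> inj_on (coords N \<psi>) {1..N} \<and>
      existence_condition N \<psi>"
  proof -
    have "x \<in> extensional {1..N} \<and> (\<forall>i\<in>{1..N}. x i = coords N \<psi> i) \<longleftrightarrow>
        x = restrict (coords N \<psi>) {1..N}"
      by (auto intro: extensionalityI)
    then show ?thesis
      using inj_on_restrict_eq by metis
  qed
  finally show ?thesis
    using assms by (simp only: inj_on_coords_iff)
qed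

text \<open>For \<open>N = 3\<close> each of the three index ranges is \<open>{1..0}\<close>, so the
  condition is vacuous.\<close>

lemma existence_condition_3: "existence_condition 3 \<psi>"
  by (simp add: existence_condition_def numeral_3_eq_3 numeral_2_eq_2)

section \<open>The one-parameter family for \<open>N = 2\<close>\<close>

lemma infinite_solutions_2: "infinite {x. is_solution 2 \<psi> x}"
proof -
  \<comment> \<open>The only equation is \<open>x 1 + x 2 = \<psi> 1\<close>, so the first
    coordinate \<open>t\<close> is free except for \<open>\<psi> 1 / 2\<close>, where both
    coordinates coincide.\<close>
  define f where "f t = restrict (\<lambda>i. if i = 1 then t else \<psi> 1 - t) {1..2::nat}" for t
  have two: "{1..2::nat} = {1, 2}"
    by auto
  have pair: "lex_pair 2 1 = (1, 2)"
    using lex_pair_Suc_first_row[of 1 1] by (simp add: numeral_2_eq_2)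
  have "is_solution 2 \<psi> (f t)" if "t \<noteq> \<psi> 1 / 2" for t
    using that pair by (auto simp: is_solution_def f_def two field_simps simp del: One_nat_def)
  then have "f ` (- {\<psi> 1 / 2}) \<subseteq> {x. is_solution 2 \<psi> x}"
    by auto
  moreover have "inj f"
    by (rule injI) (auto simp: f_def fun_eq_iff two split: if_splits dest: spec[of _ 1])
  then have "infinite (f ` (- {\<psi> 1 / 2}))"
    by (subst finite_image_iff) (auto intro: inj_on_subset simp: infinite_UNIV_char_0 finite_compl)
  ultimately show ?thesis
    by (rule infinite_super)
qed

section \<open>Rational distances on the parabola\<close>

lemma sqrt_one_plus_ratio_Rats:
  assumes "r \<in> pythagorean_ratios"
  shows "sqrt (1 + (of_rat r)\<^sup>2) \<in> \<rat>"
proof (cases "r = 0")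
  case False
  then obtain a b c where r: "r = of_int b / of_int a" and t: "pythagorean_triplet a b c"
    using assms by (auto simp: pythagorean_ratios_def)
  from t have "a \<noteq> 0" and "real_of_int (a\<^sup>2 + b\<^sup>2) = real_of_int (c\<^sup>2)"
    by (auto simp: pythagorean_triplet_def)
  \<comment> \<open>Dividing the equation of the triplet by the square of \<open>a\<close> exhibits
    a rational square.\<close>
  then have "1 + (of_rat r)\<^sup>2 = (of_int c / of_int a :: real)\<^sup>2"
    by (simp add: r of_rat_divide field_simps)
  then show ?thesis
    by simp
qed simp

text \<open>Factoring the difference of squares leaves a root that depends only on the sum of the
  abscissas, which for a solution is a Pythagorean ratio.\<close>

lemma dist_parabola:
  fixes u v :: real
  shows "dist (u, u\<^sup>2) (v, v\<^sup>2) = \<bar>u - v\<bar> * sqrt (1 + (u + v)\<^sup>2)"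
proof -
  have "(u - v)\<^sup>2 + (u\<^sup>2 - v\<^sup>2)\<^sup>2 = (u - v)\<^sup>2 * (1 + (u + v)\<^sup>2)"
    by algebra
  then show ?thesis
    by (simp add: dist_Pair_Pair dist_real_def real_sqrt_mult)
qed

text \<open>Every pair i < j occurs in the lexicographic list, so its sum is one of the given
  values.\<close>

lemma is_solution_sum_in:
  assumes "is_solution N \<psi> x" and "\<forall>k\<in>{1..N choose 2}. \<psi> k \<in> A"
    and "i \<in> {1..N}" "j \<in> {1..N}" "i < j"
  shows "x i + x j \<in> A"
proof -
  have "(i, j) \<in> set (lex_pairs N)"
    using assms by (simp add: set_lex_pairs)
  then obtain k where "k < N choose 2" "lex_pairs N ! k = (i, j)"
    by (auto simp: in_set_conv_nth length_lex_pairs)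
  \<comment> \<open>List positions count from 0, while \<open>lex_pair\<close> counts from
    1.\<close>
  then have "Suc k \<in> {1..N choose 2}" "lex_pair N (Suc k) = (i, j)"
    by (auto simp: lex_pair_def)
  then show ?thesis
    using assms(1,2) unfolding is_solution_def by (metis fst_conv snd_conv)
qed

lemma is_solution_RDS_parabola:
  assumes "is_solution N \<psi> x" and \<psi>: "\<forall>k\<in>{1..N choose 2}. \<psi> k \<in> pythagorean_ratios"
  shows "RDS_parabola N ((\<lambda>i. (of_rat (x i), (of_rat (x i))\<^sup>2)) ` {1..N})"
proof -
  let ?p = "\<lambda>i. (of_rat (x i) :: real, (of_rat (x i) :: real)\<^sup>2)"
  have "inj_on x {1..N}"
    using assms by (simp add: is_solution_def)
  then have "inj_on ?p {1..N}"
    by (auto intro!: inj_onI simp: inj_on_eq_iff)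
  then have "card (?p ` {1..N}) = N"
    by (simp add: card_image)
  moreover have dist_less: "dist (?p i) (?p j) \<in> \<rat>"
    if "i \<in> {1..N}" "j \<in> {1..N}" "i < j" for i j
    using sqrt_one_plus_ratio_Rats[OF is_solution_sum_in[OF assms that]]
    by (simp add: dist_parabola of_rat_add)
  \<comment> \<open>The equations cover only i < j; symmetry gives the reverse order, and the
    diagonal has distance 0.\<close>
  moreover have "dist (?p i) (?p j) \<in> \<rat>" if "i \<in> {1..N}" "j \<in> {1..N}" for i j
    using dist_less[of i j] dist_less[of j i] that
    by (cases i j rule: linorder_cases) (simp_all add: dist_commute)
  ultimately show ?thesis
    by (auto simp: RDS_parabola_def simp del: One_nat_def)
qed

section \<open>The distance property and the cases \<open>N = 2\<close>, \<open>N = 3\<close> and N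
  \<ge> 4\<close>

theorem theorem3p1:
  fixes N :: nat and \<psi> :: "nat \<Rightarrow> rat"
  assumes "N \<ge> 2"
    and "\<psi> \<in> {1..N choose 2} \<rightarrow>\<^sub>E pythagorean_ratios"
  shows "(\<forall>x. is_solution N \<psi> x \<longrightarrow>
            RDS_parabola N ((\<lambda>i. (of_rat (x i), (of_rat (x i))\<^sup>2)) ` {1..N})) \<and>
         (N = 2 \<longrightarrow> infinite {x. is_solution N \<psi> x}) \<and>
         (N = 3 \<longrightarrow> distinct_coordinates N \<psi> \<longrightarrow>
            (\<exists>!x. is_solution N \<psi> x) \<and>
            (\<forall>x. is_solution N \<psi> x \<longrightarrow>
               x 1 = (\<psi> 1 + \<psi> 2 - \<psi> 3) / 2 \<and>
               x 2 = (\<psi> 1 - \<psi> 2 + \<psi> 3) / 2 \<and>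
               x 3 = (- \<psi> 1 + \<psi> 2 + \<psi> 3) / 2)) \<and>
         (N \<ge> 4 \<longrightarrow>
            ((\<exists>x. is_solution N \<psi> x) \<longleftrightarrow>
               distinct_coordinates N \<psi> \<and> existence_condition N \<psi>) \<and>
            (distinct_coordinates N \<psi> \<and> existence_condition N \<psi> \<longrightarrow>
               (\<exists>!x. is_solution N \<psi> x) \<and>
               (\<forall>x. is_solution N \<psi> x \<longrightarrow>
                  x 1 = (\<psi> 1 + \<psi> 2 - \<psi> N) / 2 \<and>
                  x 2 = (\<psi> 1 - \<psi> 2 + \<psi> N) / 2 \<and>
                  x 3 = (- \<psi> 1 + \<psi> 2 + \<psi> N) / 2 \<and>
                  (\<forall>i\<in>{4..N}. x i = (- \<psi> 1 - \<psi> 2 + 2 * \<psi> (i - 1) + \<psi> N) / 2))))"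
proof -
  have "\<forall>k\<in>{1..N choose 2}. \<psi> k \<in> pythagorean_ratios"
    using assms(2) by (simp add: PiE_def Pi_def)
  then have rds: "\<forall>x. is_solution N \<psi> x \<longrightarrow>
      RDS_parabola N ((\<lambda>i. (of_rat (x i), (of_rat (x i))\<^sup>2)) ` {1..N})"
    using is_solution_RDS_parabola by blast
  have unique: "\<exists>!x. is_solution N \<psi> x"
    if "N \<ge> 3" "distinct_coordinates N \<psi>" "existence_condition N \<psi>"
    using that by (simp add: is_solution_iff)
  have conditions: "distinct_coordinates N \<psi> \<and> existence_condition N \<psi>"
    if "N \<ge> 3" "is_solution N \<psi> x" for x
    using that by (simp add: is_solution_iff)
  have formulas: "x 1 = (\<psi> 1 + \<psi> 2 - \<psi> N) / 2 \<and> x 2 = (\<psi> 1 - \<psi> 2 + \<psi> N) / 2 \<and>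
      x 3 = (- \<psi> 1 + \<psi> 2 + \<psi> N) / 2 \<and>
      (\<forall>i\<in>{4..N}. x i = (- \<psi> 1 - \<psi> 2 + 2 * \<psi> (i - 1) + \<psi> N) / 2)"
    if "N \<ge> 3" "is_solution N \<psi> x" for x
    using that by (simp add: is_solution_iff coords_def)
  show ?thesis
  proof (intro conjI[OF rds] conjI impI)
    show "infinite {x. is_solution N \<psi> x}" if "N = 2"
      using infinite_solutions_2 that by simp
  next
    assume "N = 3" "distinct_coordinates N \<psi>"
    then show "\<exists>!x. is_solution N \<psi> x"
      using unique existence_condition_3 by simp
  next
    assume "N = 3"
    then show "\<forall>x. is_solution N \<psi> x \<longrightarrow>
               x 1 = (\<psi> 1 + \<psi> 2 - \<psi> 3) / 2 \<and>
               x 2 = (\<psi> 1 - \<psi> 2 + \<psi> 3) / 2 \<and>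
               x 3 = (- \<psi> 1 + \<psi> 2 + \<psi> 3) / 2"
      using formulas by simp
  next
    assume "N \<ge> 4"
    then have "N \<ge> 3"
      by simp
    then show "(\<exists>x. is_solution N \<psi> x) \<longleftrightarrow> distinct_coordinates N \<psi> \<and> existence_condition N \<psi>"
      using unique conditions by blast
  next
    assume "N \<ge> 4" "distinct_coordinates N \<psi> \<and> existence_condition N \<psi>"
    then show "\<exists>!x. is_solution N \<psi> x"
      using unique by simp
  next
    assume "N \<ge> 4"
    then have "N \<ge> 3"
      by simp
    then show "\<forall>x. is_solution N \<psi> x \<longrightarrow>
                  x 1 = (\<psi> 1 + \<psi> 2 - \<psi> N) / 2 \<and>
                  x 2 = (\<psi> 1 - \<psi> 2 + \<psi> N) / 2 \<and>
                  x 3 = (- \<psi> 1 + \<psi> 2 + \<psi> N) / 2 \<and>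
                  (\<forall>i\<in>{4..N}. x i = (- \<psi> 1 - \<psi> 2 + 2 * \<psi> (i - 1) + \<psi> N) / 2)"
      using formulas by blast
  qed
qed

end
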